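(* Let $f$ be a transcendental entire function. If $f$ has a Baker wandering domain, then $f$ has a Baker omitted value.
   Context: $\widehat{\mathbb{C}}=\mathbb{C}\cup\{\infty\}$, and $D_r(a)$ is the open ball centered at $a\in\widehat{\mathbb{C}}$ with radius $r$ with respect to the spherical metric. A point $a\in\widehat{\mathbb{C}}$ is an omitted value of $f$ if $f(z)\neq a$ for every $z\in\mathbb{C}$. An omitted value $a\in\widehat{\mathbb{C}}$ of $f$ is a Baker omitted value (bov) if there exists $r_0>0$ such that for all $r$ with $0<r<r_0$, each component of the boundary of $f^{-1}(D_r(a))$ (boundary taken in $\mathbb{C}$) is bounded. The Fatou set $\mathcal{F}(f)$ is the set of $z\in\mathbb{C}$ having a neighborhood on which the iterates $\{f^n\}_{n>0}$ form a normal family (every sequence of iterates has a subsequence converging, uniformly on compact subsets, either to a finite limit function or to $\infty$). A Fatou component is a connected component of $\mathcal{F}(f)$. For a Fatou component $U$, $U_k$ denotes the Fatou component containing $f^k(U)$. $U$ is wandering if $U_n\neq U_m$ for all $n\neq m$. A multiply connected Fatou component $U$ surrounds a point $c\in\mathbb{C}$ if some bounded component of $\widehat{\mathbb{C}}\setminus U$ contains $c$. A Baker wandering domain is a wandering Fatou component $U$ such that, for all $n$ large enough, $U_n$ is bounded, multiply connected and surrounds $0$, and $f^n(z)\to\infty$ as $n\to\infty$ for $z\in U$. *)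

theory Defs
  imports "HOL-Complex_Analysis.Complex_Analysis"
begin

definition transcendental_entire :: "(complex \<Rightarrow> complex) \<Rightarrow> bool" where
  "transcendental_entire f \<longleftrightarrow> f holomorphic_on UNIV \<and> \<not> (\<exists>p. \<forall>z. f z = poly p z)"

text \<open>The extended complex plane: \<open>None\<close> is the point at infinity.\<close>

type_synonym ext_complex = "complex option"

abbreviation ext_top :: "ext_complex topology" where
  "ext_top \<equiv> Alexandroff_compactification euclidean"

text \<open>Inverse stereographic projection onto the unit sphere of \<open>complex \<times> real\<close>, sending
  \<open>\<infinity>\<close> to the north pole; the spherical metric is the geodesic (great-circle) distance there.
  The chordal metric has the same balls up to a monotone change of the radius.\<close>

fun stereo :: "ext_complex \<Rightarrow> complex \<times> real" where
  "stereo None = (0, 1)"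
| "stereo (Some z) =
     (2 * z / of_real ((cmod z)\<^sup>2 + 1), ((cmod z)\<^sup>2 - 1) / ((cmod z)\<^sup>2 + 1))"

definition spherical_dist :: "ext_complex \<Rightarrow> ext_complex \<Rightarrow> real" where
  "spherical_dist a b = arccos (stereo a \<bullet> stereo b)"

definition spherical_ball :: "ext_complex \<Rightarrow> real \<Rightarrow> ext_complex set" where
  "spherical_ball a r = {b. spherical_dist a b < r}"

definition omitted_value :: "(complex \<Rightarrow> complex) \<Rightarrow> ext_complex \<Rightarrow> bool" where
  "omitted_value f a \<longleftrightarrow> (\<forall>z. Some (f z) \<noteq> a)"

definition baker_omitted_value :: "(complex \<Rightarrow> complex) \<Rightarrow> ext_complex \<Rightarrow> bool" where
  "baker_omitted_value f a \<longleftrightarrow>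
     omitted_value f a \<and>
     (\<exists>r\<^sub>0>0. \<forall>r. 0 < r \<and> r < r\<^sub>0 \<longrightarrow>
        (\<forall>C \<in> components (frontier ((\<lambda>z. Some (f z)) -` spherical_ball a r)). bounded C))"

text \<open>The second disjunct is locally uniform convergence to \<open>\<infinity>\<close>.\<close>

definition normal_family_on :: "complex set \<Rightarrow> (complex \<Rightarrow> complex) set \<Rightarrow> bool" where
  "normal_family_on W \<F> \<longleftrightarrow>
     (\<forall>g :: nat \<Rightarrow> complex \<Rightarrow> complex. range g \<subseteq> \<F> \<longrightarrow>
        (\<exists>s :: nat \<Rightarrow> nat. strict_mono s \<and>
           ((\<exists>h. \<forall>K. compact K \<and> K \<subseteq> W \<longrightarrow> uniform_limit K (\<lambda>n. g (s n)) h sequentially) \<or>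
            (\<forall>K. compact K \<and> K \<subseteq> W \<longrightarrow>
               (\<forall>B. \<forall>\<^sub>F n in sequentially. \<forall>z\<in>K. B < cmod (g (s n) z))))))"

definition fatou_set :: "(complex \<Rightarrow> complex) \<Rightarrow> complex set" where
  "fatou_set f = {z. \<exists>W. open W \<and> z \<in> W \<and> normal_family_on W {f ^^ n |n. 0 < n}}"

definition fatou_component :: "(complex \<Rightarrow> complex) \<Rightarrow> complex set \<Rightarrow> bool" where
  "fatou_component f U \<longleftrightarrow> U \<in> components (fatou_set f)"

text \<open>The component \<open>U\<^sub>k\<close> exists and is unique because, for nonconstant entire \<open>f\<close>, the Fatou
  set is forward invariant.\<close>

definition fatou_iterate :: "(complex \<Rightarrow> complex) \<Rightarrow> complex set \<Rightarrow> nat \<Rightarrow> complex set" where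
  "fatou_iterate f U k = (THE V. fatou_component f V \<and> (f ^^ k) ` U \<subseteq> V)"

definition wandering_domain :: "(complex \<Rightarrow> complex) \<Rightarrow> complex set \<Rightarrow> bool" where
  "wandering_domain f U \<longleftrightarrow>
     fatou_component f U \<and> (\<forall>m n. m \<noteq> n \<longrightarrow> fatou_iterate f U m \<noteq> fatou_iterate f U n)"

definition multiply_connected :: "complex set \<Rightarrow> bool" where
  "multiply_connected U \<longleftrightarrow> connected U \<and> \<not> simply_connected U"

text \<open>Components are taken in the extended plane, with \<open>U\<close> viewed as a subset of it; one is
  bounded if it is the image of a bounded set \<open>K\<close> of finite points.\<close>

definition surrounds :: "complex set \<Rightarrow> complex \<Rightarrow> bool" where
  "surrounds U c \<longleftrightarrow>
     (\<exists>K. Some ` K \<in> connected_components_of (subtopology ext_top (- (Some ` U)))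
        \<and> bounded K \<and> c \<in> K)"

definition baker_wandering_domain :: "(complex \<Rightarrow> complex) \<Rightarrow> complex set \<Rightarrow> bool" where
  "baker_wandering_domain f U \<longleftrightarrow>
     wandering_domain f U \<and>
     (\<forall>\<^sub>F n in sequentially.
        bounded (fatou_iterate f U n) \<and>
        multiply_connected (fatou_iterate f U n) \<and>
        surrounds (fatou_iterate f U n) 0) \<and>
     (\<forall>z\<in>U. filterlim (\<lambda>n. (f ^^ n) z) at_infinity sequentially)"

end

theory Submission
  imports Defs
begin

text \<open>The omitted value is \<open>\<infinity>\<close>. The iterates tend to \<open>\<infinity>\<close> locally uniformly on a multiply
  connected iterate \<open>V\<close> of the Baker wandering domain, and there is a bounded open set \<open>G\<close> that
  meets the complement of \<open>V\<close> but has its frontier in \<open>V\<close>. Since \<open>G\<close> cannot lie in the Fatou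
  set, the images \<open>f\<^sup>n(G)\<close> contain arbitrarily large discs about the origin. An unbounded connected
  set \<open>C\<close> on which \<open>f\<close> is bounded therefore meets the frontier of such an image, which lies in
  \<open>f\<^sup>n(frontier G)\<close>; but \<open>f\<close> maps this intersection into \<open>f\<^sup>n\<^sup>+\<^sup>1(frontier G)\<close>, where the
  modulus is large.\<close>

section \<open>Uniform escape of iterates\<close>

text \<open>\<open>K\<close> is arbitrary: a singleton expresses escape of a single orbit, an open
  set gives locally uniform escape.\<close>

definition escapes_uniformly_on :: "complex set \<Rightarrow> (complex \<Rightarrow> complex) \<Rightarrow> bool" where
  "escapes_uniformly_on K f \<longleftrightarrow> (\<forall>B. \<forall>\<^sub>F n in sequentially. \<forall>z\<in>K. B < cmod ((f ^^ n) z))"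

lemma escapes_uniformly_onD:
  "escapes_uniformly_on K f \<Longrightarrow> \<forall>\<^sub>F n in sequentially. \<forall>z\<in>K. B < cmod ((f ^^ n) z)"
  by (simp add: escapes_uniformly_on_def)

lemma escapes_uniformly_on_subset:
  "escapes_uniformly_on K f \<Longrightarrow> L \<subseteq> K \<Longrightarrow> escapes_uniformly_on L f"
  unfolding escapes_uniformly_on_def by (intro allI, drule spec, erule eventually_mono) blast

lemma escapes_uniformly_on_singleton:
  assumes "filterlim (\<lambda>n. (f ^^ n) z) at_infinity sequentially"
  shows "escapes_uniformly_on {z} f"
  using filterlim_at_infinity_imp_norm_at_top[OF assms]
  by (auto simp: escapes_uniformly_on_def filterlim_at_top_dense)

lemma escapes_uniformly_on_finite_Union:
  assumes "finite I" "\<And>i. i \<in> I \<Longrightarrow> escapes_uniformly_on (A i) f"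
  shows "escapes_uniformly_on (\<Union>i\<in>I. A i) f"
  using assms by (simp add: escapes_uniformly_on_def eventually_ball_finite)

lemma infinitely_often_strict_mono:
  fixes P :: "nat \<Rightarrow> bool"
  assumes "\<exists>\<^sub>F n in sequentially. P n"
  obtains t :: "nat \<Rightarrow> nat" where "strict_mono t" "\<And>n. P (t n)"
proof -
  have "infinite {n. P n}"
    using assms by (simp add: frequently_cofinite flip: cofinite_eq_sequentially)
  then show thesis
    using that infinite_enumerate[of "{n. P n}"] by auto
qed

text \<open>Otherwise infinitely many iterates take a value of modulus at most \<open>B\<close> on
  \<open>K\<close>. Normality gives a subsequence of these; a finite limit contradicts escape at
  \<open>w\<close>, and divergence to infinity contradicts the bound on \<open>K\<close>.\<close>

lemma escapes_uniformly_on_normal_set: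
  assumes W: "normal_family_on W {f ^^ n |n. 0 < n}"
    and w: "w \<in> W" "escapes_uniformly_on {w} f"
    and K: "compact K" "K \<subseteq> W"
  shows "escapes_uniformly_on K f"
proof (rule ccontr)
  assume "\<not> escapes_uniformly_on K f"
  then obtain B where "\<exists>\<^sub>F n in sequentially. \<exists>z\<in>K. cmod ((f ^^ n) z) \<le> B"
    by (auto simp: escapes_uniformly_on_def not_eventually not_less)
  \<comment> \<open>The normal family contains only iterates of positive order.\<close>
  then have "\<exists>\<^sub>F n in sequentially. (\<exists>z\<in>K. cmod ((f ^^ n) z) \<le> B) \<and> 0 < n"
    by (rule frequently_eventually_frequently) (rule eventually_gt_at_top)
  then obtain t :: "nat \<Rightarrow> nat" where t: "strict_mono t"
    and tB: "\<And>n. (\<exists>z\<in>K. cmod ((f ^^ t n) z) \<le> B) \<and> 0 < t n"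
    by (rule infinitely_often_strict_mono) blast
  have "range (\<lambda>n. f ^^ t n) \<subseteq> {f ^^ n |n. 0 < n}"
    using tB by auto
  then obtain s :: "nat \<Rightarrow> nat" where s: "strict_mono s"
    and alt: "(\<exists>h. \<forall>K. compact K \<and> K \<subseteq> W \<longrightarrow> uniform_limit K (\<lambda>n. f ^^ t (s n)) h sequentially) \<or>
            (\<forall>K. compact K \<and> K \<subseteq> W \<longrightarrow>
               (\<forall>B. \<forall>\<^sub>F n in sequentially. \<forall>z\<in>K. B < cmod ((f ^^ t (s n)) z)))"
    using W unfolding normal_family_on_def by blast
  from alt show False
  proof (elim disjE exE)
    fix h
    assume "\<forall>K. compact K \<and> K \<subseteq> W \<longrightarrow> uniform_limit K (\<lambda>n. f ^^ t (s n)) h sequentially"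
    then have "uniform_limit {w} (\<lambda>n. f ^^ t (s n)) h sequentially"
      using w by (meson compact_sing empty_subsetI insert_subset)
    then have "\<forall>\<^sub>F n in sequentially. \<forall>z\<in>{w}. dist ((f ^^ t (s n)) z) (h z) < 1"
      by (rule uniform_limitD) simp
    moreover
    have ts: "filterlim (t \<circ> s) sequentially sequentially"
      using s t by (simp add: filterlim_subseq strict_mono_o)
    have "\<forall>\<^sub>F n in sequentially. cmod (h w) + 1 < cmod ((f ^^ t (s n)) w)"
      using eventually_compose_filterlim[OF escapes_uniformly_onD[OF w(2)] ts] by simp
    ultimately have "\<forall>\<^sub>F n in sequentially. False"
    proof eventually_elim
      case (elim n)
      then show ?case
        using norm_triangle_ineq2[of "(f ^^ t (s n)) w" "h w"] by (simp add: dist_norm)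
    qed
    then show False by simp
  next
    assume "\<forall>K. compact K \<and> K \<subseteq> W \<longrightarrow>
               (\<forall>B. \<forall>\<^sub>F n in sequentially. \<forall>z\<in>K. B < cmod ((f ^^ t (s n)) z))"
    then have "\<forall>\<^sub>F n in sequentially. \<forall>z\<in>K. B < cmod ((f ^^ t (s n)) z)"
      using K by blast
    then obtain n where "\<forall>z\<in>K. B < cmod ((f ^^ t (s n)) z)"
      by (auto dest: eventually_happens)
    then show False
      using tB[of "s n"] by force
  qed
qed

section \<open>Spread of escape within a Fatou component\<close>

lemma open_fatou_set: "open (fatou_set f)"
  unfolding fatou_set_def open_subopen[of "Collect _"] by blast

lemma open_fatou_component: "fatou_component f V \<Longrightarrow> open V"
  using fatou_component_def open_components open_fatou_set by blast

text \<open>By normality, escape at one point spreads uniformly to small balls. Pointwise escape is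
  thus locally constant, hence constant on the connected \<open>V\<close>, and finitely many balls
  cover \<open>K\<close>.\<close>

lemma escapes_uniformly_on_fatou_component:
  assumes V: "fatou_component f V" and w: "w \<in> V" "escapes_uniformly_on {w} f"
    and K: "compact K" "K \<subseteq> V"
  shows "escapes_uniformly_on K f"
proof -
  have VF: "V \<subseteq> fatou_set f" and "connected V"
    using V by (auto simp: fatou_component_def in_components_subset dest: in_components_connected)
  have nhd: "\<exists>U. open U \<and> z \<in> U \<and> U \<subseteq> V \<and>
      (\<forall>u\<in>U. escapes_uniformly_on {u} f \<longrightarrow> escapes_uniformly_on U f)" if "z \<in> V" for z
  proof -
    have "z \<in> fatou_set f"
      using VF that by blast
    then obtain W where W: "open W" "z \<in> W" "normal_family_on W {f ^^ n |n. 0 < n}"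
      unfolding fatou_set_def by blast
    then have "open (W \<inter> V)" "z \<in> W \<inter> V"
      using open_fatou_component[OF V] that by auto
    then obtain e where e: "e > 0" "cball z e \<subseteq> W \<inter> V"
      using open_contains_cball[THEN iffD1, rule_format] by metis
    have "escapes_uniformly_on (ball z e) f"
      if u: "u \<in> ball z e" "escapes_uniformly_on {u} f" for u
    proof -
      have "u \<in> W"
        using u e by auto
      then have "escapes_uniformly_on (cball z e) f"
        using escapes_uniformly_on_normal_set[OF W(3) _ u(2)] e by auto
      then show ?thesis
        using ball_subset_cball escapes_uniformly_on_subset by blast
    qed
    then show ?thesis
      using e by (intro exI[of _ "ball z e"]) auto
  qed
  have all: "escapes_uniformly_on {z} f" if "z \<in> V" for z
  proof -
    have "(escapes_uniformly_on {w} f) = (escapes_uniformly_on {z} f)"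
    proof (rule connected_equivalence_relation[OF \<open>connected V\<close> w(1) that])
      fix a assume "a \<in> V"
      then obtain U where U: "open U" "a \<in> U" "U \<subseteq> V"
        "\<forall>u\<in>U. escapes_uniformly_on {u} f \<longrightarrow> escapes_uniformly_on U f"
        using nhd by blast
      have "\<forall>x\<in>U. escapes_uniformly_on {a} f = escapes_uniformly_on {x} f"
        using U(2,4) escapes_uniformly_on_subset[of U f] by blast
      then show "\<exists>T. openin (top_of_set V) T \<and> a \<in> T \<and>
          (\<forall>x\<in>T. escapes_uniformly_on {a} f = escapes_uniformly_on {x} f)"
        using U open_subset by blast
    qed auto
    with w show ?thesis by simp
  qed
  have "\<exists>U. open U \<and> z \<in> U \<and> escapes_uniformly_on U f" if "z \<in> K" for z
  proof -
    have "z \<in> V"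
      using K that by blast
    from nhd[OF this] all[OF this] show ?thesis
      by blast
  qed
  then obtain U where U: "\<And>z. z \<in> K \<Longrightarrow> open (U z) \<and> z \<in> U z \<and> escapes_uniformly_on (U z) f"
    by metis
  obtain D where D: "D \<subseteq> K" "finite D" "K \<subseteq> (\<Union>z\<in>D. U z)"
    using compactE_image[OF K(1), of K U] U by blast
  then have "escapes_uniformly_on (\<Union>z\<in>D. U z) f"
    using U by (intro escapes_uniformly_on_finite_Union) auto
  then show ?thesis
    using D escapes_uniformly_on_subset by blast
qed

section \<open>Escape and membership in the Fatou set\<close>

text \<open>Either the exponents tend to infinity and the sequence itself diverges, or one exponent
  recurs infinitely often and yields a constant subsequence.\<close>

lemma normal_family_on_if_escapes_uniformly_on:
  assumes G: "escapes_uniformly_on G f"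
  shows "normal_family_on G {f ^^ n |n. 0 < n}"
  unfolding normal_family_on_def
proof (intro allI impI)
  fix g :: "nat \<Rightarrow> complex \<Rightarrow> complex"
  assume "range g \<subseteq> {f ^^ n |n. 0 < n}"
  then have "\<forall>n. \<exists>k. g n = f ^^ k" by blast
  then obtain k where k: "\<And>n. g n = f ^^ k n" by metis
  show "\<exists>s :: nat \<Rightarrow> nat. strict_mono s \<and>
           ((\<exists>h. \<forall>K. compact K \<and> K \<subseteq> G \<longrightarrow> uniform_limit K (\<lambda>n. g (s n)) h sequentially) \<or>
            (\<forall>K. compact K \<and> K \<subseteq> G \<longrightarrow>
               (\<forall>B. \<forall>\<^sub>F n in sequentially. \<forall>z\<in>K. B < cmod (g (s n) z))))"
  proof (cases "filterlim k at_top sequentially")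
    case True
    have "\<forall>\<^sub>F n in sequentially. \<forall>z\<in>K. B < cmod (g n z)" if "K \<subseteq> G" for K B
      using eventually_compose_filterlim[OF escapes_uniformly_onD[OF G] True, of B]
      by (rule eventually_mono) (use that k in auto)
    then show ?thesis
      by (intro exI[of _ id]) (auto simp: strict_mono_id)
  next
    case False
    then obtain N where "\<exists>\<^sub>F n in sequentially. k n < N"
      by (auto simp: filterlim_at_top not_eventually not_le)
    then obtain t :: "nat \<Rightarrow> nat" where t: "strict_mono t" "\<And>n. k (t n) < N"
      by (rule infinitely_often_strict_mono) blast
    have "finite (range (k \<circ> t))"
      using t by (auto intro: finite_subset[of _ "{..<N}"])
    then obtain m where "infinite {n. (k \<circ> t) n = m}"
      using pigeonhole_infinite[of "UNIV :: nat set" "k \<circ> t"] by auto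
    then obtain s :: "nat \<Rightarrow> nat" where s: "strict_mono s" "\<And>n. k (t (s n)) = m"
      using infinite_enumerate[of "{n. (k \<circ> t) n = m}"] by auto
    have "uniform_limit K (\<lambda>n. g ((t \<circ> s) n)) (f ^^ m) sequentially" for K
      using s by (simp add: k uniform_limit_const)
    then show ?thesis
      using s t strict_mono_o by blast
  qed
qed

text \<open>Escape would put \<open>G\<close> in the Fatou set. A component of \<open>G\<close>
  through a point outside \<open>V\<close> has its frontier in the open set \<open>V\<close>, so it
  meets \<open>V\<close> and would be absorbed by this Fatou component.\<close>

lemma not_escapes_uniformly_on_if_frontier_subset:
  assumes V: "fatou_component f V"
    and G: "open G" "bounded G" "frontier G \<subseteq> V" "\<not> G \<subseteq> V"
  shows "\<not> escapes_uniformly_on G f"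
proof
  assume "escapes_uniformly_on G f"
  then have GF: "G \<subseteq> fatou_set f"
    using G(1) normal_family_on_if_escapes_uniformly_on by (auto simp: fatou_set_def)
  obtain x where x: "x \<in> G" "x \<notin> V"
    using G(4) by blast
  define E where "E = connected_component_set G x"
  have "x \<in> E" "E \<subseteq> G" "connected E"
    using x connected_component_subset[of G x] by (auto simp: E_def)
  then have "frontier E \<noteq> {}"
    by (metis G(2) bounded_subset empty_iff frontier_not_empty not_bounded_UNIV)
  moreover have "frontier E \<subseteq> V"
    using frontier_of_connected_component_subset[of G x] G(3) by (auto simp: E_def)
  ultimately have "V \<inter> closure E \<noteq> {}"
    by (auto simp: frontier_def)
  then have "V \<inter> E \<noteq> {}"
    using open_Int_closure_eq_empty[OF open_fatou_component[OF V]] by blast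
  then have "E \<subseteq> V"
    using components_maximal[of V "fatou_set f" E] V \<open>connected E\<close> \<open>E \<subseteq> G\<close> GF
    by (auto simp: fatou_component_def)
  with x \<open>x \<in> E\<close> show False by blast
qed

section \<open>Isolating a hole of a multiply connected domain\<close>

lemma bounded_open_with_frontier_in:
  fixes V :: "complex set"
  assumes "open V" "multiply_connected V"
  obtains G where "open G" "bounded G" "frontier G \<subseteq> V" "\<not> G \<subseteq> V"
proof -
  obtain C where C: "C \<in> components (- V)" "bounded C"
    using assms simply_connected_eq_unbounded_complement_components[OF assms(1)]
    by (auto simp: multiply_connected_def)
  have "closed (- V)"
    using assms by auto
  then have "compact C"
    using C closed_components compact_eq_bounded_closed by blast
  \<comment> \<open>Other components of \<open>- V\<close> may accumulate at \<open>C\<close>, so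
    \<open>C\<close> is enlarged to a compact relatively clopen \<open>K\<close>, which can be
    separated from the rest of \<open>- V\<close>.\<close>
  obtain K where K: "openin (top_of_set (- V)) K" "compact K" "C \<subseteq> K"
    using Sura_Bura_clopen_subset[of "- V" C UNIV] C \<open>compact C\<close> \<open>closed (- V)\<close>
    by (metis closed_imp_locally_compact open_UNIV subset_UNIV)
  have "closedin (top_of_set (- V)) (- V - K)"
    using K(1) by (simp add: closedin_diff)
  then have "closed (- V - K)"
    using \<open>closed (- V)\<close> closedin_closed_trans by blast
  then obtain G H where GH: "open G" "compact (closure G)" "open H" "K \<subseteq> G" "- V - K \<subseteq> H" "G \<inter> H = {}"
    using separation_normal_compact[OF K(2), of "- V - K"] by blast
  show thesis
  proof
    show "bounded G"
      using bounded_subset[OF compact_imp_bounded[OF GH(2)] closure_subset] .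
    \<comment> \<open>The frontier of \<open>G\<close> avoids \<open>K\<close>, which lies in the
      open \<open>G\<close>, and avoids \<open>H\<close>, so it misses all of
      \<open>- V\<close>.\<close>
    have "closure G \<inter> H = {}"
      using GH(3,6) open_Int_closure_eq_empty by blast
    then show "frontier G \<subseteq> V"
      using GH by (auto simp: frontier_def interior_open)
    show "\<not> G \<subseteq> V"
      using C K(3) GH(4) in_components_nonempty in_components_subset by blast
  qed fact
qed

section \<open>Images under iterates cover large discs\<close>

lemma iterate_open_image:
  assumes "f holomorphic_on UNIV" "\<not> f constant_on UNIV" "open G"
  shows "open ((f ^^ n) ` G)"
proof (induction n)
  case (Suc n)
  have "open (f ` (f ^^ n) ` G)"
    using open_mapping_thm[OF assms(1) open_UNIV connected_UNIV Suc _ assms(2)] by simp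
  then show ?case by (simp add: image_comp)
qed (use assms in simp)

lemma frontier_open_image_subset:
  fixes g :: "complex \<Rightarrow> complex"
  assumes "continuous_on UNIV g" "bounded G" "open (g ` G)"
  shows "frontier (g ` G) \<subseteq> g ` frontier G"
proof -
  have "compact (g ` closure G)"
    using assms by (meson compact_closure compact_continuous_image continuous_on_subset subset_UNIV)
  then have "closure (g ` G) \<subseteq> g ` closure G"
    by (simp add: closure_minimal closure_subset compact_imp_closed image_mono)
  then show ?thesis
    unfolding frontier_def interior_open[OF assms(3)] using interior_subset[of G] by blast
qed

text \<open>A ball meeting \<open>S\<close> without lying in it is connected, so it would meet the
  frontier of \<open>S\<close>.\<close>

lemma ball_subset_if_disjoint_frontier:
  fixes S :: "complex set"
  assumes "\<not> ball 0 B \<subseteq> S" "\<forall>z\<in>frontier S. B < cmod z" "z \<in> S"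
  shows "B \<le> cmod z"
proof (rule ccontr)
  assume "\<not> B \<le> cmod z"
  then have "z \<in> ball 0 B \<inter> S"
    using assms(3) by auto
  then have "ball 0 B \<inter> frontier S \<noteq> {}"
    using assms(1) connected_Int_frontier[of "ball 0 B" S] by blast
  with assms(2) show False by fastforce
qed

lemma bounded_connected_if_bounded_image:
  assumes f: "f holomorphic_on UNIV" "\<not> f constant_on UNIV"
    and V: "fatou_component f V" "multiply_connected V"
    and w: "w \<in> V" "escapes_uniformly_on {w} f"
    and C: "connected C" "bounded (f ` C)"
  shows "bounded C"
proof (rule ccontr)
  assume unb: "\<not> bounded C"
  obtain G where G: "open G" "bounded G" "frontier G \<subseteq> V" "\<not> G \<subseteq> V"
    using bounded_open_with_frontier_in[OF open_fatou_component[OF V(1)] V(2)] .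
  have contf: "continuous_on UNIV (f ^^ n)" for n
  proof (induction n)
    case (Suc n)
    then show ?case
      using continuous_on_compose[of UNIV "f ^^ n" f] holomorphic_on_imp_continuous_on[OF f(1)]
        continuous_on_subset by (metis funpow.simps(2) subset_UNIV)
  qed (simp add: id_def)
  have opn: "open ((f ^^ n) ` G)" for n
    using iterate_open_image[OF f G(1)] .
  have fr: "frontier ((f ^^ n) ` G) \<subseteq> (f ^^ n) ` frontier G" for n
    using frontier_open_image_subset[OF contf G(2) opn] .
  have "escapes_uniformly_on (frontier G) f"
    using escapes_uniformly_on_fatou_component[OF V(1) w _ G(3)] G(2) by (simp add: compact_frontier_bounded)
  then have esc: "\<forall>\<^sub>F n in sequentially. \<forall>z\<in>frontier G. B < cmod ((f ^^ n) z)" for B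
    by (rule escapes_uniformly_onD)
  have large: "\<exists>\<^sub>F n in sequentially. ball 0 B \<subseteq> (f ^^ n) ` G" for B
  proof (rule ccontr)
    assume "\<not> ?thesis"
    then have no: "\<forall>\<^sub>F n in sequentially. \<not> ball 0 B \<subseteq> (f ^^ n) ` G"
      by (simp add: not_frequently)
    have "escapes_uniformly_on G f"
      unfolding escapes_uniformly_on_def
    proof
      fix A
      \<comment> \<open>\<open>M \<ge> B\<close> keeps the larger disc uncovered; the extra 1 turns
        the weak bound \<open>M \<le> cmod ((f ^^ n) z)\<close> into a strict one by
        \<open>A\<close>.\<close>
      define M where "M = max B (A + 1)"
      show "\<forall>\<^sub>F n in sequentially. \<forall>z\<in>G. A < cmod ((f ^^ n) z)"
        using no esc[of M]
      proof eventually_elim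
        case (elim n)
        have "ball 0 B \<subseteq> ball (0::complex) M"
          by (auto simp: M_def)
        then have "\<not> ball 0 M \<subseteq> (f ^^ n) ` G"
          using elim(1) by blast
        moreover have "\<forall>z\<in>frontier ((f ^^ n) ` G). M < cmod z"
          using elim(2) fr[of n] by blast
        ultimately have "M \<le> cmod ((f ^^ n) z)" if "z \<in> G" for z
          using ball_subset_if_disjoint_frontier that by blast
        then show ?case
          by (force simp: M_def)
      qed
    qed
    with not_escapes_uniformly_on_if_frontier_subset[OF V(1) G] show False ..
  qed
  obtain c where c: "c \<in> C"
    using unb by fastforce
  obtain R where R: "\<And>z. z \<in> C \<Longrightarrow> cmod (f z) \<le> R"
    using C(2) by (auto simp: bounded_iff)
  have "\<forall>\<^sub>F n in sequentially. \<forall>z\<in>frontier G. R < cmod ((f ^^ Suc n) z)"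
    using esc[of R] eventually_sequentially_Suc[of "\<lambda>n. \<forall>z\<in>frontier G. R < cmod ((f ^^ n) z)"]
    by blast
  \<comment> \<open>The radius is chosen to put \<open>c\<close> inside the covered disc, so that
    \<open>C\<close> meets the bounded image and also leaves it.\<close>
  then have "\<exists>\<^sub>F n in sequentially. ball 0 (cmod c + 1) \<subseteq> (f ^^ n) ` G \<and>
      (\<forall>z\<in>frontier G. R < cmod ((f ^^ Suc n) z))"
    using large frequently_eventually_frequently by blast
  then obtain n where n: "ball 0 (cmod c + 1) \<subseteq> (f ^^ n) ` G"
      "\<forall>z\<in>frontier G. R < cmod ((f ^^ Suc n) z)"
    using frequently_ex by blast
  have "bounded ((f ^^ n) ` G)"
    by (meson G(2) bounded_subset closure_subset compact_closure compact_continuous_image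
        compact_imp_bounded contf continuous_on_subset image_mono subset_UNIV)
  then have "C - (f ^^ n) ` G \<noteq> {}"
    using unb bounded_subset by blast
  moreover have "C \<inter> (f ^^ n) ` G \<noteq> {}"
    using n(1) c by force
  ultimately have "C \<inter> frontier ((f ^^ n) ` G) \<noteq> {}"
    using connected_Int_frontier[OF C(1)] by metis
  then obtain x where "x \<in> frontier G" "(f ^^ n) x \<in> C"
    using subsetD[OF fr[of n]] by fastforce
  with n(2) R[of "(f ^^ n) x"] show False
    by force
qed

section \<open>Spherical circles about infinity\<close>

lemma spherical_dist_infinity:
  "spherical_dist None (Some z) = arccos (((cmod z)\<^sup>2 - 1) / ((cmod z)\<^sup>2 + 1))"
  by (simp add: spherical_dist_def)

text \<open>The preimage is a strict sublevel set of a continuous function, so its frontier lies in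
  the level set.\<close>

lemma frontier_preimage_spherical_ball_infinity:
  assumes "continuous_on UNIV f" "z \<in> frontier ((\<lambda>z. Some (f z)) -` spherical_ball None r)"
  shows "spherical_dist None (Some (f z)) = r"
proof -
  define g where "g z = spherical_dist None (Some (f z))" for z
  have pos: "(cmod (f z))\<^sup>2 + 1 > 0" for z
    by (simp add: add_nonneg_pos)
  have "continuous_on UNIV g"
    unfolding g_def spherical_dist_infinity
  proof (intro continuous_intros assms ballI)
    fix z
    show "(cmod (f z))\<^sup>2 + 1 \<noteq> 0" using pos[of z] by simp
    show "- 1 \<le> ((cmod (f z))\<^sup>2 - 1) / ((cmod (f z))\<^sup>2 + 1) \<and>
      ((cmod (f z))\<^sup>2 - 1) / ((cmod (f z))\<^sup>2 + 1) \<le> 1"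
      using pos[of z] by (simp add: field_simps)
  qed
  then have "open {z. g z < r}" "closed {z. g z \<le> r}"
    by (auto intro!: open_Collect_less closed_Collect_le)
  moreover from this(2) have "closure {z. g z < r} \<subseteq> {z. g z \<le> r}"
    by (rule closure_minimal[rotated]) auto
  ultimately have "frontier {z. g z < r} \<subseteq> {z. g z \<le> r} - {z. g z < r}"
    by (auto simp: frontier_def interior_open)
  then show ?thesis
    using assms(2) by (auto simp: spherical_ball_def g_def)
qed

lemma spherical_dist_infinity_pos_imp_bounded:
  assumes "0 < r"
  shows "bounded {z. spherical_dist None (Some z) = r}"
proof -
  \<comment> \<open>For \<open>r > pi\<close> the level set is empty, as \<open>arccos\<close> never
    exceeds \<open>pi\<close>; the minimum keeps \<open>q < 1\<close> for every positive
    \<open>r\<close>.\<close>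
  define q where "q = cos (min r pi)"
  have "q < 1"
    using assms cos_monotone_0_pi[of 0 "min r pi"] by (simp add: q_def)
  have "cmod z \<le> 1 + 2 / (1 - q)" if "spherical_dist None (Some z) = r" for z
  proof -
    define t where "t = (cmod z)\<^sup>2"
    have t: "t \<ge> 0" by (simp add: t_def)
    then have "- 1 \<le> (t - 1) / (t + 1)" "(t - 1) / (t + 1) \<le> 1"
      by (simp_all add: field_simps)
    moreover have ar: "arccos ((t - 1) / (t + 1)) = r"
      using that by (simp add: spherical_dist_infinity t_def)
    ultimately have "r \<le> pi" "cos r = (t - 1) / (t + 1)"
      using arccos_ubound by auto
    then have "q = (t - 1) / (t + 1)"
      by (simp add: q_def)
    then have "1 - q = 2 / (1 + t)"
      using t by (simp add: field_simps)
    then have "1 + t = 2 / (1 - q)"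
      by simp
    \<comment> \<open>Expanding \<open>(cmod z - 1)^2 \<ge> 0\<close> gives
      \<open>2 * cmod z \<le> 1 + t\<close>.\<close>
    moreover have "cmod z \<le> 1 + t"
      using zero_le_power2[of "cmod z - 1"] norm_ge_zero[of z]
      unfolding t_def power2_diff by (simp; linarith)
    ultimately show ?thesis by simp
  qed
  then show ?thesis
    by (auto simp: bounded_iff)
qed

section \<open>Fatou components along a wandering orbit\<close>

text \<open>If the defining description of \<open>fatou_iterate f U k\<close> had no solution for two values of
  \<open>k\<close>, both iterates would be the same junk value, contradicting that \<open>U\<close> is wandering.\<close>
lemma wandering_domain_fatou_iterate:
  assumes U: "wandering_domain f U"
  shows "\<forall>\<^sub>F n in sequentially. fatou_component f (fatou_iterate f U n) \<and> (f ^^ n) ` U \<subseteq> fatou_iterate f U n"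
proof -
  define P where "P n V \<longleftrightarrow> fatou_component f V \<and> (f ^^ n) ` U \<subseteq> V" for n V
  have fi: "fatou_iterate f U n = (THE V. P n V)" for n
    by (simp add: fatou_iterate_def P_def)
  have "U \<noteq> {}"
    using U in_components_nonempty by (auto simp: wandering_domain_def fatou_component_def)
  then have uniq: "V = V'" if "P n V" "P n V'" for n V V'
    using that components_eq[of V "fatou_set f" V'] unfolding P_def fatou_component_def by blast
  have "m = n" if "\<nexists>V. P m V" "\<nexists>V. P n V" for m n
  proof -
    have "P m = P n" using that by blast
    then have "fatou_iterate f U m = fatou_iterate f U n" by (simp add: fi)
    with U show ?thesis by (auto simp: wandering_domain_def)
  qed
  \<comment> \<open>At most one index lacks a solution, so all larger ones have it.\<close>
  then obtain N where "\<And>n. n > N \<Longrightarrow> \<exists>V. P n V"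
    by (metis less_irrefl)
  then have "P n (fatou_iterate f U n)" if "n > N" for n
    using that uniq unfolding fi by (metis theI)
  then show ?thesis
    unfolding P_def by (rule eventually_mono[OF eventually_gt_at_top[of N]])
qed

section \<open>Infinity as a Baker omitted value\<close>

theorem theorem3p2:
  fixes f :: "complex \<Rightarrow> complex"
  assumes "transcendental_entire f"
    and "\<exists>U. baker_wandering_domain f U"
  shows "\<exists>a. baker_omitted_value f a"
proof -
  have f: "f holomorphic_on UNIV" and "\<nexists>p. \<forall>z. f z = poly p z"
    using assms(1) by (auto simp: transcendental_entire_def)
  have nc: "\<not> f constant_on UNIV"
  proof
    assume "f constant_on UNIV"
    then obtain c where "\<forall>z. f z = poly [:c:] z"
      by (auto simp: constant_on_def)
    with \<open>\<nexists>p. \<forall>z. f z = poly p z\<close> show False by blast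
  qed
  obtain U where U: "wandering_domain f U"
    and mc: "\<forall>\<^sub>F n in sequentially. multiply_connected (fatou_iterate f U n)"
    and lim: "\<forall>z\<in>U. filterlim (\<lambda>n. (f ^^ n) z) at_infinity sequentially"
    using assms(2) by (auto simp: baker_wandering_domain_def eventually_conj_iff)
  obtain u where u: "u \<in> U"
    using U in_components_nonempty by (fastforce simp: wandering_domain_def fatou_component_def)
  obtain n where V: "fatou_component f (fatou_iterate f U n)" "multiply_connected (fatou_iterate f U n)"
    and img: "(f ^^ n) ` U \<subseteq> fatou_iterate f U n"
    using eventually_happens[OF eventually_conj[OF wandering_domain_fatou_iterate[OF U] mc]] by auto
  \<comment> \<open>The orbit of \<open>(f ^^ n) u\<close> is a tail of the orbit of
    \<open>u\<close>, so it escapes too.\<close>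
  have "filterlim (\<lambda>k. (f ^^ (k + n)) u) at_infinity sequentially"
    using filterlim_compose[OF bspec[OF lim u] filterlim_add_const_nat_at_top] .
  then have "escapes_uniformly_on {(f ^^ n) u} f"
    by (intro escapes_uniformly_on_singleton) (simp add: funpow_add)
  then have bdd: "bounded C" if "connected C" "bounded (f ` C)" for C
    using bounded_connected_if_bounded_image[OF f nc V] img u that by blast
  have "bounded C"
    if "0 < r" "C \<in> components (frontier ((\<lambda>z. Some (f z)) -` spherical_ball None r))" for r C
  proof (rule bdd)
    show "connected C"
      using that(2) in_components_connected by blast
    have "f ` C \<subseteq> {w. spherical_dist None (Some w) = r}"
      using frontier_preimage_spherical_ball_infinity[OF holomorphic_on_imp_continuous_on[OF f]]
        in_components_subset[OF that(2)] by blast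
    then show "bounded (f ` C)"
      using bounded_subset spherical_dist_infinity_pos_imp_bounded[OF that(1)] by blast
  qed
  \<comment> \<open>Finite values never equal infinity. Boundedness holds for every positive radius,
    so the threshold 1 is an arbitrary choice.\<close>
  then have "baker_omitted_value f None"
    by (auto simp: baker_omitted_value_def omitted_value_def intro!: exI[of _ "1::real"])
  then show ?thesis ..
qed

end
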